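(* (Extinction-explosion principle.) For the branching-within-branching process described in the context, the parasite population either dies out or explodes: for every $\vec{s}\in\mathbf{N}$, $$\mathbb{P}_{\vec s}(\mathcal{Z}_n\to0)+\mathbb{P}_{\vec s}(\mathcal{Z}_n\to\infty)=1.$$
   Context: Branching-within-branching process (BwBP): Let $\mathbb{V}$ be the Ulam-Harris tree with root $\varnothing$. Let $(N_\mathsf{v})_{\mathsf{v}\in\mathbb{V}}$ be i.i.d. copies of an $\mathbb{N}_0$-valued random variable $N$ with law $(p_k)_{k\ge0}$ and finite mean $\nu=\mathbb{E}N$; each cell $\mathsf{v}$ has $N_\mathsf{v}$ daughter cells $\mathsf{v}1,\dots,\mathsf{v}N_\mathsf{v}$, giving a Galton-Watson cell tree with generations $\mathbb{T}_n$. For each $k\in\mathbb{N}$ let $X^{(\bullet,k)}=(X^{(1,k)},\dots,X^{(k,k)})$ be an $\mathbb{N}_0^k$-valued random vector and $X^{(\bullet,k)}_{i,\mathsf{v}}$ i.i.d. copies, independent over $k$ and of $(N_\mathsf{v})$; $X^{(j,k)}_{i,\mathsf{v}}:=0$ for $j>k$. If cell $\mathsf{v}$ contains $Z_\mathsf{v}$ parasites, daughter $\mathsf{v}j$ contains $Z_{\mathsf{v}j}=\sum_{i=1}^{Z_\mathsf{v}}X^{(j,N_\mathsf{v})}_{i,\mathsf{v}}$ parasites ($X^{(j,k)}_{i,\mathsf{v}}$ is the offspring of the $i$-th parasite of $\mathsf{v}$ going to the $j$-th daughter when there are $k$ daughters). Cells in one generation with their parasites evolve independently. $\mathcal{Z}_n=\sum_{\mathsf{v}\in\mathbb{T}_n}Z_\mathsf{v}$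 is the total number of parasites in generation $n$. Put $\mu_{j,k}=\mathbb{E}X^{(j,k)}$, $\gamma=\sum_{k\ge1}p_k\sum_{j=1}^k\mu_{j,k}$. Standing assumptions: $0<\gamma<\infty$; $p_1<1$ and, starting from one cell with one parasite, $\mathbb{P}(\mathcal{Z}_1=1)<1$; $p_k\,\mathbb{P}(X^{(j,k)}\ge2)>0$ for at least one pair $1\le j\le k$. $\mathbf{N}=\{(x_i)_{i\ge0}\in\mathbb{N}_0^\infty: x_i>0\text{ for only finitely many }i\}$, and for $\vec s=(s_0,s_1,\dots)\in\mathbf{N}$, $\mathbb{P}_{\vec s}$ denotes the law of the process started with $s_k$ cells containing exactly $k$ parasites, for each $k\ge0$. *)

theory Defs
  imports "HOL-Probability.Probability"
begin

text \<open>Cells: a vertex (k, l, w) is the cell with Ulam-Harris address w in the cell tree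
  rooted at the l-th initial cell among those starting with exactly k parasites.
  Daughters of cell (k,l,w) are (k,l,w@[j]), j = 1..N.
  Nc v w0: number of daughter cells of v (outcome w0).
  X k i v w0: the vector (X^(1,k)_{i,v}, ..., X^(k,k)_{i,v}) as a list of length k;
  component j (1-based) is the list entry at position j - 1.\<close>

type_synonym cell = "nat \<times> nat \<times> nat list"

text \<open>Number of parasites in cell (k,l,rev rp); recursion on the reversed address rp.\<close>
primrec bwbp_Zr ::
  "(nat \<Rightarrow> nat) \<Rightarrow> (cell \<Rightarrow> 'a \<Rightarrow> nat) \<Rightarrow> (nat \<Rightarrow> nat \<Rightarrow> cell \<Rightarrow> 'a \<Rightarrow> nat list)
   \<Rightarrow> nat \<Rightarrow> nat \<Rightarrow> nat list \<Rightarrow> 'a \<Rightarrow> nat" where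
  "bwbp_Zr s Nc X k l [] \<omega> = (if l < s k then k else 0)"
| "bwbp_Zr s Nc X k l (j # rp) \<omega> =
     (let u = (k, l, rev rp) in
      if 1 \<le> j \<and> j \<le> Nc u \<omega>
      then (\<Sum>i = 1..bwbp_Zr s Nc X k l rp \<omega>. X (Nc u \<omega>) i u \<omega> ! (j - 1))
      else 0)"

definition bwbp_Z ::
  "(nat \<Rightarrow> nat) \<Rightarrow> (cell \<Rightarrow> 'a \<Rightarrow> nat) \<Rightarrow> (nat \<Rightarrow> nat \<Rightarrow> cell \<Rightarrow> 'a \<Rightarrow> nat list)
   \<Rightarrow> cell \<Rightarrow> 'a \<Rightarrow> nat" where
  "bwbp_Z s Nc X v \<omega> = (case v of (k, l, w) \<Rightarrow> bwbp_Zr s Nc X k l (rev w) \<omega>)"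

text \<open>Generation n of the cell forest started from s (s k initial cells with k parasites).\<close>
definition bwbp_T ::
  "(nat \<Rightarrow> nat) \<Rightarrow> (cell \<Rightarrow> 'a \<Rightarrow> nat) \<Rightarrow> nat \<Rightarrow> 'a \<Rightarrow> cell set" where
  "bwbp_T s Nc n \<omega> = {(k, l, w). l < s k \<and> length w = n \<and>
      (\<forall>m < n. 1 \<le> w ! m \<and> w ! m \<le> Nc (k, l, take m w) \<omega>)}"

definition bwbp_total ::
  "(nat \<Rightarrow> nat) \<Rightarrow> (cell \<Rightarrow> 'a \<Rightarrow> nat) \<Rightarrow> (nat \<Rightarrow> nat \<Rightarrow> cell \<Rightarrow> 'a \<Rightarrow> nat list)
   \<Rightarrow> nat \<Rightarrow> 'a \<Rightarrow> nat" where
  "bwbp_total s Nc X n \<omega> = (\<Sum>v \<in> bwbp_T s Nc n \<omega>. bwbp_Z s Nc X v \<omega>)"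

definition bwbp_mu :: "(nat \<Rightarrow> nat list pmf) \<Rightarrow> nat \<Rightarrow> nat \<Rightarrow> ennreal" where
  "bwbp_mu Q j k = (\<integral>\<^sup>+ xs. ennreal (real (xs ! (j - 1))) \<partial>measure_pmf (Q k))"

definition bwbp_gamma :: "nat pmf \<Rightarrow> (nat \<Rightarrow> nat list pmf) \<Rightarrow> ennreal" where
  "bwbp_gamma p Q = (\<Sum>k. ennreal (pmf p (Suc k)) * (\<Sum>j = 1..Suc k. bwbp_mu Q j (Suc k)))"

definition bwbp_index :: "(cell + (nat \<times> nat \<times> cell)) set" where
  "bwbp_index = range Inl \<union> {Inr (k, i, v) | k i v. 1 \<le> k \<and> 1 \<le> i}"

definition bwbp_family ::
  "(cell \<Rightarrow> 'a \<Rightarrow> nat) \<Rightarrow> (nat \<Rightarrow> nat \<Rightarrow> cell \<Rightarrow> 'a \<Rightarrow> nat list)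
   \<Rightarrow> (cell + (nat \<times> nat \<times> cell)) \<Rightarrow> 'a \<Rightarrow> nat + nat list" where
  "bwbp_family Nc X \<iota> \<omega> = (case \<iota> of Inl v \<Rightarrow> Inl (Nc v \<omega>) | Inr (k, i, v) \<Rightarrow> Inr (X k i v \<omega>))"

end

theory Submission
  imports Defs
begin

text \<open>It suffices that every total \<open>k \<ge> 1\<close> is almost surely visited only finitely often, and
  for this a bound \<open>P(total n = k, no visit to k after n) \<ge> \<delta> P(total n = k)\<close> with \<open>\<delta> > 0\<close>
  independent of \<open>n\<close> is enough: the events on the left are disjoint, so the visit probabilities
  are summable and Borel-Cantelli applies.
  To get the bound, split \<open>total n = k\<close> according to the countably many placements of the \<open>k\<close>
  parasites in the cells of generation \<open>n\<close>, which are independent of the variables attached to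
  these cells. If a single parasite can leave no offspring, then with probability bounded below
  all \<open>k\<close> parasites do so at once, and 0 is absorbing. Otherwise the total is almost surely
  nondecreasing, and one parasite having two or more offspring makes it exceed \<open>k\<close> forever.\<close>

abbreviation cell_gen :: "cell \<Rightarrow> nat" where
  "cell_gen v \<equiv> length (snd (snd v))"

lemma bwbp_Z_root: "bwbp_Z s Nc X (k, l, []) \<omega> = (if l < s k then k else 0)"
  by (simp add: bwbp_Z_def)

lemma bwbp_Z_daughter:
  "bwbp_Z s Nc X (k, l, w @ [j]) \<omega> =
     (if 1 \<le> j \<and> j \<le> Nc (k, l, w) \<omega>
      then \<Sum>i = 1..bwbp_Z s Nc X (k, l, w) \<omega>. X (Nc (k, l, w) \<omega>) i (k, l, w) \<omega> ! (j - 1)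
      else 0)"
  by (simp add: bwbp_Z_def Let_def)

lemma bwbp_T_0: "bwbp_T s Nc 0 \<omega> = (\<lambda>(k, l). (k, l, [])) ` (SIGMA k:{k. s k > 0}. {..<s k})"
  by (auto simp: bwbp_T_def image_iff)

lemma snoc_in_bwbp_T:
  "(k, l, w @ [j]) \<in> bwbp_T s Nc (Suc n) \<omega> \<longleftrightarrow>
     (k, l, w) \<in> bwbp_T s Nc n \<omega> \<and> 1 \<le> j \<and> j \<le> Nc (k, l, w) \<omega>"
  by (auto simp: bwbp_T_def nth_append less_Suc_eq_le le_less all_conj_distrib)

lemma bwbp_T_Suc:
  "bwbp_T s Nc (Suc n) \<omega> =
     (\<lambda>((k, l, w), j). (k, l, w @ [j])) ` (SIGMA v:bwbp_T s Nc n \<omega>. {1..Nc v \<omega>})"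
  (is "_ = ?f ` ?S")
proof (intro equalityI subsetI)
  fix v assume v: "v \<in> bwbp_T s Nc (Suc n) \<omega>"
  obtain k l w where vw: "v = (k, l, w)" by (cases v)
  have "w \<noteq> []" using v vw by (auto simp: bwbp_T_def)
  then obtain u j where w: "w = u @ [j]" by (metis append_butlast_last_id)
  have "((k, l, u), j) \<in> ?S" using v unfolding vw w snoc_in_bwbp_T by simp
  then show "v \<in> ?f ` ?S" unfolding vw w by (force intro: image_eqI)
next
  fix v assume "v \<in> ?f ` ?S"
  then obtain k l w j where "(k, l, w) \<in> bwbp_T s Nc n \<omega>" "j \<in> {1..Nc (k, l, w) \<omega>}"
    "v = (k, l, w @ [j])" by auto
  then show "v \<in> bwbp_T s Nc (Suc n) \<omega>" by (simp add: snoc_in_bwbp_T)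
qed

lemma finite_bwbp_T:
  assumes "finite {k. s k > 0}"
  shows "finite (bwbp_T s Nc n \<omega>)"
proof (induction n)
  case 0
  show ?case unfolding bwbp_T_0 using assms by (intro finite_imageI finite_SigmaI) auto
next
  case (Suc n)
  then show ?case unfolding bwbp_T_Suc by (intro finite_imageI finite_SigmaI) auto
qed

lemma bwbp_T_if_bwbp_Z_pos:
  assumes "bwbp_Z s Nc X (k, l, w) \<omega> > 0"
  shows "(k, l, w) \<in> bwbp_T s Nc (length w) \<omega>"
  using assms
proof (induction w rule: rev_induct)
  case Nil
  then show ?case by (auto simp: bwbp_Z_root bwbp_T_0 image_iff split: if_splits)
next
  case (snoc j w)
  then have j: "1 \<le> j \<and> j \<le> Nc (k, l, w) \<omega>"
    and *: "(\<Sum>i = 1..bwbp_Z s Nc X (k, l, w) \<omega>. X (Nc (k, l, w) \<omega>) i (k, l, w) \<omega> ! (j - 1)) > 0"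
    by (auto simp: bwbp_Z_daughter split: if_splits)
  have "bwbp_Z s Nc X (k, l, w) \<omega> > 0" by (rule ccontr) (use * in simp)
  with snoc.IH j show ?case by (simp add: snoc_in_bwbp_T)
qed

definition bwbp_config ::
  "(nat \<Rightarrow> nat) \<Rightarrow> (cell \<Rightarrow> 'a \<Rightarrow> nat) \<Rightarrow> (nat \<Rightarrow> nat \<Rightarrow> cell \<Rightarrow> 'a \<Rightarrow> nat list)
   \<Rightarrow> nat \<Rightarrow> 'a \<Rightarrow> cell \<Rightarrow> nat" where
  "bwbp_config s Nc X n \<omega> v = (if cell_gen v = n then bwbp_Z s Nc X v \<omega> else 0)"

definition bwbp_offspring ::
  "(cell \<Rightarrow> 'a \<Rightarrow> nat) \<Rightarrow> (nat \<Rightarrow> nat \<Rightarrow> cell \<Rightarrow> 'a \<Rightarrow> nat list) \<Rightarrow> cell \<Rightarrow> nat \<Rightarrow> 'a \<Rightarrow> nat" where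
  "bwbp_offspring Nc X v i \<omega> = (\<Sum>j = 1..Nc v \<omega>. X (Nc v \<omega>) i v \<omega> ! (j - 1))"

lemma supp_bwbp_config: "{v. bwbp_config s Nc X n \<omega> v \<noteq> 0} \<subseteq> bwbp_T s Nc n \<omega>"
  by (auto simp: bwbp_config_def intro!: bwbp_T_if_bwbp_Z_pos split: if_splits)

lemma finite_supp_bwbp_config:
  "finite {k. s k > 0} \<Longrightarrow> finite {v. bwbp_config s Nc X n \<omega> v \<noteq> 0}"
  by (rule finite_subset[OF supp_bwbp_config finite_bwbp_T])

lemma bwbp_total_eq_config:
  assumes "finite {k. s k > 0}"
  shows "bwbp_total s Nc X n \<omega> =
    (\<Sum>v | bwbp_config s Nc X n \<omega> v \<noteq> 0. bwbp_config s Nc X n \<omega> v)"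
  unfolding bwbp_total_def
  by (rule sum.mono_neutral_cong_right[OF finite_bwbp_T[OF assms] supp_bwbp_config])
     (auto simp: bwbp_config_def bwbp_T_def split: if_splits)

lemma bwbp_total_Suc:
  assumes "finite {k. s k > 0}"
  shows "bwbp_total s Nc X (Suc n) \<omega> =
    (\<Sum>v | bwbp_config s Nc X n \<omega> v \<noteq> 0.
       \<Sum>i = 1..bwbp_config s Nc X n \<omega> v. bwbp_offspring Nc X v i \<omega>)"
proof -
  let ?Z = "\<lambda>v. bwbp_Z s Nc X v \<omega>"
  let ?f = "\<lambda>((k, l, w), j). (k, l, w @ [j]) :: cell"
  have inj: "inj_on ?f A" for A by (auto simp: inj_on_def)
  have "bwbp_total s Nc X (Suc n) \<omega> =
      (\<Sum>(v, j) \<in> (SIGMA v:bwbp_T s Nc n \<omega>. {1..Nc v \<omega>}). ?Z (?f (v, j)))"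
    unfolding bwbp_total_def bwbp_T_Suc by (subst sum.reindex[OF inj]) (simp add: case_prod_beta)
  also have "\<dots> = (\<Sum>v \<in> bwbp_T s Nc n \<omega>. \<Sum>j = 1..Nc v \<omega>. ?Z (?f (v, j)))"
    by (subst sum.Sigma) (auto simp: finite_bwbp_T assms)
  also have "\<dots> = (\<Sum>v \<in> bwbp_T s Nc n \<omega>. \<Sum>j = 1..Nc v \<omega>.
      \<Sum>i = 1..?Z v. X (Nc v \<omega>) i v \<omega> ! (j - 1))"
    by (intro sum.cong refl) (auto simp: bwbp_Z_daughter split: prod.splits)
  also have "\<dots> = (\<Sum>v \<in> bwbp_T s Nc n \<omega>. \<Sum>i = 1..?Z v. bwbp_offspring Nc X v i \<omega>)"
    unfolding bwbp_offspring_def by (intro sum.cong refl sum.swap)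
  also have "\<dots> = (\<Sum>v | bwbp_config s Nc X n \<omega> v \<noteq> 0.
       \<Sum>i = 1..bwbp_config s Nc X n \<omega> v. bwbp_offspring Nc X v i \<omega>)"
    by (rule sum.mono_neutral_cong_right[OF finite_bwbp_T[OF assms] supp_bwbp_config])
       (auto simp: bwbp_config_def bwbp_T_def split: if_splits)
  finally show ?thesis .
qed

lemma bwbp_config_cong:
  assumes "\<And>v. cell_gen v < n \<Longrightarrow> Nc v \<omega> = Nc' v \<omega>'"
    and "\<And>v k i. cell_gen v < n \<Longrightarrow> 1 \<le> k \<Longrightarrow> 1 \<le> i \<Longrightarrow> X k i v \<omega> = X' k i v \<omega>'"
  shows "bwbp_config s Nc X n \<omega> = bwbp_config s Nc' X' n \<omega>'"
proof -
  have "bwbp_Z s Nc X (k, l, w) \<omega> = bwbp_Z s Nc' X' (k, l, w) \<omega>'" if "length w \<le> n" for k l w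
    using that
  proof (induction w rule: rev_induct)
    case (snoc j w)
    then show ?case by (auto simp: bwbp_Z_daughter assms intro!: sum.cong)
  qed (simp add: bwbp_Z_root)
  then show ?thesis by (auto simp: bwbp_config_def fun_eq_iff)
qed

lemma measurable_bwbp_config:
  assumes N: "\<And>v. cell_gen v < n \<Longrightarrow> Nc v \<in> M \<rightarrow>\<^sub>M count_space UNIV"
    and X: "\<And>v k i. cell_gen v < n \<Longrightarrow> 1 \<le> k \<Longrightarrow> 1 \<le> i \<Longrightarrow> X k i v \<in> M \<rightarrow>\<^sub>M count_space UNIV"
  shows "{\<omega> \<in> space M. bwbp_config s Nc X n \<omega> = c} \<in> sets M"
proof -
  have Z: "bwbp_Z s Nc X (k, l, w) \<in> M \<rightarrow>\<^sub>M count_space UNIV" if "length w \<le> n" for k l w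
    using that
  proof (induction w rule: rev_induct)
    case Nil
    have "bwbp_Z s Nc X (k, l, []) = (\<lambda>_. if l < s k then k else 0)"
      by (simp add: fun_eq_iff bwbp_Z_root)
    then show ?case by simp
  next
    case (snoc j w)
    let ?u = "(k, l, w)"
    have [measurable]: "bwbp_Z s Nc X ?u \<in> M \<rightarrow>\<^sub>M count_space UNIV" using snoc by simp
    have [measurable]: "Nc ?u \<in> M \<rightarrow>\<^sub>M count_space UNIV" using snoc N by simp
    have "(\<lambda>\<omega>. if 1 \<le> j \<and> j \<le> a then \<Sum>i = 1..z. X a i ?u \<omega> ! (j - 1) else 0)
        \<in> M \<rightarrow>\<^sub>M count_space UNIV" for a z
    proof (cases "1 \<le> j \<and> j \<le> a")
      case True
      have [measurable]: "X a i ?u \<in> M \<rightarrow>\<^sub>M count_space UNIV" if "i \<in> {1..z}" for i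
        using that True snoc X by simp
      have "(\<lambda>\<omega>. X a i ?u \<omega> ! (j - 1)) \<in> M \<rightarrow>\<^sub>M count_space UNIV" if "i \<in> {1..z}" for i
        using that by measurable
      then have "(\<lambda>\<omega>. \<Sum>i = 1..z. X a i ?u \<omega> ! (j - 1)) \<in> M \<rightarrow>\<^sub>M count_space UNIV"
        by (rule measurable_sum_nat)
      with True show ?thesis by simp
    qed auto
    note F = this
    have "(\<lambda>\<omega>. if 1 \<le> j \<and> j \<le> Nc ?u \<omega>
        then \<Sum>i = 1..bwbp_Z s Nc X ?u \<omega>. X (Nc ?u \<omega>) i ?u \<omega> ! (j - 1) else 0)
        \<in> M \<rightarrow>\<^sub>M count_space UNIV"
      by (rule measurable_compose_countable[where g = "Nc ?u"],
          rule measurable_compose_countable[where g = "bwbp_Z s Nc X ?u"], rule F) measurable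
    then show ?case by (simp add: bwbp_Z_daughter cong: measurable_cong)
  qed
  have "(\<lambda>\<omega>. bwbp_config s Nc X n \<omega> v) \<in> M \<rightarrow>\<^sub>M count_space UNIV" for v
    using Z[of "snd (snd v)" "fst v" "fst (snd v)"] by (cases "cell_gen v = n") (auto simp: bwbp_config_def)
  then have "{\<omega> \<in> space M. \<forall>v. bwbp_config s Nc X n \<omega> v = c v} \<in> sets M"
    by measurable
  then show ?thesis by (simp add: fun_eq_iff)
qed

lemma countable_finite_supp:
  "countable {c :: 'b::countable \<Rightarrow> nat. finite {v. c v \<noteq> 0}}"
proof (rule countable_image_inj_on)
  let ?g = "\<lambda>c::'b \<Rightarrow> nat. (\<lambda>v. (v, c v)) ` {v. c v \<noteq> 0}"
  show "countable (?g ` {c. finite {v. c v \<noteq> 0}})"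
    by (rule countable_subset[OF _ countable_Collect_finite]) auto
  show "inj_on ?g {c. finite {v. c v \<noteq> 0}}"
  proof (rule inj_onI, rule ext)
    fix c d :: "'b \<Rightarrow> nat" and v
    assume eq: "?g c = ?g d"
    have "(v, x) \<in> ?g c \<longleftrightarrow> c v = x \<and> x \<noteq> 0" for x by auto
    moreover have "(v, x) \<in> ?g d \<longleftrightarrow> d v = x \<and> x \<noteq> 0" for x by auto
    ultimately show "c v = d v" using eq by (metis)
  qed
qed

(* Cells are triples and must stay atomic for the simplifier. *)
declare split_paired_All [simp del] split_paired_Ex [simp del]

lemma (in prob_space) AE_eventually_ne_if_last_visit:
  fixes Z :: "nat \<Rightarrow> 'a \<Rightarrow> 'b"
  assumes Z [measurable]: "\<And>n. Z n \<in> M \<rightarrow>\<^sub>M count_space UNIV"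
    and \<delta>: "\<delta> > 0"
    and last: "\<And>n. \<delta> * prob {\<omega> \<in> space M. Z n \<omega> = k} \<le>
                    prob {\<omega> \<in> space M. Z n \<omega> = k \<and> (\<forall>m>n. Z m \<omega> \<noteq> k)}"
  shows "AE \<omega> in M. \<forall>\<^sub>F n in sequentially. Z n \<omega> \<noteq> k"
proof -
  let ?V = "\<lambda>n. {\<omega> \<in> space M. Z n \<omega> = k}"
  let ?L = "\<lambda>n. {\<omega> \<in> space M. Z n \<omega> = k \<and> (\<forall>m>n. Z m \<omega> \<noteq> k)}"
  have "disjoint_family ?L"
    unfolding disjoint_family_on_def
  proof (intro ballI impI)
    fix m n :: nat assume "m \<noteq> n"
    then consider "m < n" | "n < m" by linarith
    then show "?L m \<inter> ?L n = {}" by cases auto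
  qed
  then have "(\<lambda>n. prob (?L n)) sums prob (\<Union>n. ?L n)"
    by (intro finite_measure_UNION) auto
  then have "summable (\<lambda>n. prob (?L n) / \<delta>)"
    by (intro summable_divide sums_summable)
  moreover have "norm (prob (?V n)) \<le> prob (?L n) / \<delta>" for n
    using last[of n] \<delta> by (simp add: field_simps)
  ultimately have "summable (\<lambda>n. prob (?V n))"
    by (rule summable_comparison_test'[where N = 0])
  then have "AE \<omega> in M. \<forall>\<^sub>F n in sequentially. \<omega> \<in> space M - ?V n"
    by (intro borel_cantelli_AE1) (auto simp: less_top[symmetric])
  then show ?thesis
    by (rule AE_mp) (auto elim: eventually_mono)
qed

primrec index_gen :: "cell + nat \<times> nat \<times> cell \<Rightarrow> nat" where
  "index_gen (Inl v) = cell_gen v"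
| "index_gen (Inr kiv) = cell_gen (snd (snd kiv))"

locale bwbp = prob_space M for M :: "'a measure" +
  fixes p :: "nat pmf"
    and Q :: "nat \<Rightarrow> nat list pmf"
    and Nc :: "cell \<Rightarrow> 'a \<Rightarrow> nat"
    and X :: "nat \<Rightarrow> nat \<Rightarrow> cell \<Rightarrow> 'a \<Rightarrow> nat list"
    and s :: "nat \<Rightarrow> nat"
  assumes Q_len: "\<And>k. 1 \<le> k \<Longrightarrow> set_pmf (Q k) \<subseteq> {xs. length xs = k}"
    and indep: "indep_vars (\<lambda>_. count_space UNIV) (bwbp_family Nc X) bwbp_index"
    and law_N: "\<And>v. distr M (count_space UNIV) (Nc v) = measure_pmf p"
    and law_X: "\<And>k i v. 1 \<le> k \<Longrightarrow> 1 \<le> i \<Longrightarrow>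
                  distr M (count_space UNIV) (X k i v) = measure_pmf (Q k)"
    and s_fin: "finite {k. s k > 0}"
begin

abbreviation total :: "nat \<Rightarrow> 'a \<Rightarrow> nat" where
  "total \<equiv> bwbp_total s Nc X"

abbreviation config :: "nat \<Rightarrow> 'a \<Rightarrow> cell \<Rightarrow> nat" where
  "config \<equiv> bwbp_config s Nc X"

definition configs :: "nat \<Rightarrow> nat \<Rightarrow> (cell \<Rightarrow> nat) set" where
  "configs n k = {c. finite {v. c v \<noteq> 0} \<and> (\<forall>v. c v \<noteq> 0 \<longrightarrow> cell_gen v = n) \<and>
     (\<Sum>v | c v \<noteq> 0. c v) = k}"

definition typical :: "'a \<Rightarrow> bool" where
  "typical \<omega> \<longleftrightarrow> (\<forall>v. Nc v \<omega> \<in> set_pmf p) \<and> (\<forall>k\<ge>1. \<forall>i\<ge>1. \<forall>v. X k i v \<omega> \<in> set_pmf (Q k))"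

lemma measurable_family:
  "\<iota> \<in> bwbp_index \<Longrightarrow> bwbp_family Nc X \<iota> \<in> M \<rightarrow>\<^sub>M count_space UNIV"
  using indep by (auto simp: indep_vars_def)

lemma measurable_N [measurable]: "Nc v \<in> M \<rightarrow>\<^sub>M count_space UNIV"
proof -
  have "(\<lambda>\<omega>. projl (bwbp_family Nc X (Inl v) \<omega>)) \<in> M \<rightarrow>\<^sub>M count_space UNIV"
    by (rule measurable_compose[OF measurable_family]) (auto simp: bwbp_index_def)
  then show ?thesis by (simp add: bwbp_family_def)
qed

lemma measurable_X: "X k i v \<in> M \<rightarrow>\<^sub>M count_space UNIV" if "1 \<le> k" "1 \<le> i"
proof -
  have "(\<lambda>\<omega>. projr (bwbp_family Nc X (Inr (k, i, v)) \<omega>)) \<in> M \<rightarrow>\<^sub>M count_space UNIV"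
    by (rule measurable_compose[OF measurable_family]) (use that in \<open>auto simp: bwbp_index_def\<close>)
  then show ?thesis by (simp add: bwbp_family_def)
qed

lemma prob_family_Inl:
  "prob (bwbp_family Nc X (Inl v) -` Inl ` A \<inter> space M) = measure_pmf.prob p A"
proof -
  have "measure_pmf.prob p A = prob (Nc v -` A \<inter> space M)"
    by (simp flip: law_N[of v] add: measure_distr)
  also have "Nc v -` A = bwbp_family Nc X (Inl v) -` Inl ` A"
    by (auto simp: bwbp_family_def)
  finally show ?thesis by simp
qed

lemma prob_family_Inr:
  assumes "1 \<le> k" "1 \<le> i"
  shows "prob (bwbp_family Nc X (Inr (k, i, v)) -` Inr ` A \<inter> space M) = measure_pmf.prob (Q k) A"
proof -
  have "measure_pmf.prob (Q k) A = prob (X k i v -` A \<inter> space M)"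
    by (simp flip: law_X[OF assms, of v] add: measure_distr measurable_X[OF assms])
  also have "X k i v -` A = bwbp_family Nc X (Inr (k, i, v)) -` Inr ` A"
    by (auto simp: bwbp_family_def)
  finally show ?thesis by simp
qed

lemma AE_typical: "AE \<omega> in M. typical \<omega>"
proof -
  have "AE \<omega> in M. Nc v \<omega> \<in> set_pmf p" for v
    by (rule AE_distrD[OF measurable_N], unfold law_N, rule AE_measure_pmf)
  moreover have "AE \<omega> in M. 1 \<le> k \<longrightarrow> 1 \<le> i \<longrightarrow> X k i v \<omega> \<in> set_pmf (Q k)" for k i v
  proof (cases "1 \<le> k \<and> 1 \<le> i")
    case True
    then have ki: "1 \<le> k" "1 \<le> i" by auto
    have "AE \<omega> in M. X k i v \<omega> \<in> set_pmf (Q k)"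
      by (rule AE_distrD[OF measurable_X[OF ki]], unfold law_X[OF ki], rule AE_measure_pmf)
    then show ?thesis by (rule AE_mp) simp
  qed auto
  ultimately have "AE \<omega> in M. (\<forall>v. Nc v \<omega> \<in> set_pmf p) \<and>
      (\<forall>k i v. 1 \<le> k \<longrightarrow> 1 \<le> i \<longrightarrow> X k i v \<omega> \<in> set_pmf (Q k))"
    by (simp add: AE_all_countable)
  then show ?thesis by (rule AE_mp) (auto simp: typical_def)
qed

lemma typical_offspring:
  assumes "typical \<omega>" "1 \<le> i"
  shows "bwbp_offspring Nc X v i \<omega> = (if Nc v \<omega> = 0 then 0 else sum_list (X (Nc v \<omega>) i v \<omega>))"
proof (cases "Nc v \<omega> = 0")
  case False
  then have "1 \<le> Nc v \<omega>" by simp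
  then have "length (X (Nc v \<omega>) i v \<omega>) = Nc v \<omega>"
    using assms Q_len unfolding typical_def by blast
  then have "sum_list (X (Nc v \<omega>) i v \<omega>) = (\<Sum>j = 0..<Nc v \<omega>. X (Nc v \<omega>) i v \<omega> ! j)"
    by (simp add: sum_list_sum_nth)
  also have "\<dots> = (\<Sum>j = 1..Nc v \<omega>. X (Nc v \<omega>) i v \<omega> ! (j - 1))"
    by (rule sum.reindex_bij_witness[where i = "\<lambda>j. j - 1" and j = Suc]) auto
  finally show ?thesis using False by (simp add: bwbp_offspring_def)
qed (simp add: bwbp_offspring_def)

lemma sets_config [measurable]: "{\<omega> \<in> space M. config n \<omega> = c} \<in> sets M"
  by (intro measurable_bwbp_config measurable_N measurable_X)

lemma countable_configs: "countable (configs n k)"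
  by (rule countable_subset[OF _ countable_finite_supp]) (auto simp: configs_def)

lemma total_eq_iff_configs: "total n \<omega> = k \<longleftrightarrow> config n \<omega> \<in> configs n k"
  using finite_supp_bwbp_config[OF s_fin, of Nc X n \<omega>] bwbp_total_eq_config[OF s_fin, of Nc X n \<omega>]
  by (auto simp: configs_def) (auto simp: bwbp_config_def split: if_splits)

lemma total_Collect_eq:
  "{\<omega> \<in> space M. total n \<omega> = k \<and> P \<omega>} = (\<Union>c\<in>configs n k. {\<omega> \<in> space M. config n \<omega> = c \<and> P \<omega>})"
  by (auto simp: total_eq_iff_configs)

lemma measurable_total [measurable]: "total n \<in> M \<rightarrow>\<^sub>M count_space UNIV"
proof (rule measurable_count_space_eq2_countable[THEN iffD2])
  show "total n \<in> space M \<rightarrow> UNIV \<and> (\<forall>k\<in>UNIV. total n -` {k} \<inter> space M \<in> sets M)"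
  proof safe
    fix k
    have "total n -` {k} \<inter> space M = (\<Union>c\<in>configs n k. {\<omega> \<in> space M. config n \<omega> = c})"
      using total_Collect_eq[of n k "\<lambda>_. True"] by auto
    also have "\<dots> \<in> sets M"
      by (intro sets.countable_UN' countable_configs) auto
    finally show "total n -` {k} \<inter> space M \<in> sets M" .
  qed auto
qed

lemma prob_config_step:
  assumes J: "finite J" "J \<subseteq> bwbp_index" "\<And>\<iota>. \<iota> \<in> J \<Longrightarrow> index_gen \<iota> = n"
    and q: "0 \<le> q" "\<And>\<iota>. \<iota> \<in> J \<Longrightarrow> q \<le> prob (bwbp_family Nc X \<iota> -` S \<iota> \<inter> space M)"
  shows "q ^ card J * prob {\<omega> \<in> space M. config n \<omega> = c} \<le>
    prob {\<omega> \<in> space M. config n \<omega> = c \<and> (\<forall>\<iota>\<in>J. bwbp_family Nc X \<iota> \<omega> \<in> S \<iota>)}"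
proof -
  define A where "A = {\<iota> \<in> bwbp_index. index_gen \<iota> < n}"
  let ?F = "bwbp_family Nc X"
  let ?P = "\<lambda>I. PiM I (\<lambda>_. count_space UNIV :: (nat + nat list) measure)"
  let ?N = "\<lambda>v x. projl (x (Inl v)) :: nat"
  let ?X = "\<lambda>k i v x. projr (x (Inr (k, i, v))) :: nat list"
  define Ea where "Ea = {x \<in> space (?P A). bwbp_config s ?N ?X n x = c}"
  let ?a = "\<lambda>\<omega>. \<lambda>\<iota>\<in>A. ?F \<iota> \<omega>" and ?b = "\<lambda>\<omega>. \<lambda>\<iota>\<in>J. ?F \<iota> \<omega>"
  have inA: "Inl v \<in> A" if "cell_gen v < n" for v
    using that by (auto simp: A_def bwbp_index_def)
  have inA': "Inr (k, i, v) \<in> A" if "cell_gen v < n" "1 \<le> k" "1 \<le> i" for k i v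
    using that by (auto simp: A_def bwbp_index_def)
  have "Ea \<in> sets (?P A)"
    unfolding Ea_def
  proof (rule measurable_bwbp_config)
    show "?N v \<in> ?P A \<rightarrow>\<^sub>M count_space UNIV" if "cell_gen v < n" for v
      by (rule measurable_compose[OF measurable_component_singleton[OF inA[OF that]]]) simp
    show "?X k i v \<in> ?P A \<rightarrow>\<^sub>M count_space UNIV" if "cell_gen v < n" "1 \<le> k" "1 \<le> i" for v k i
      by (rule measurable_compose[OF measurable_component_singleton[OF inA'[OF that]]]) simp
  qed
  moreover have "Pi\<^sub>E J S \<in> sets (?P J)"
    using J by (intro sets_PiM_I_finite) auto
  moreover have "indep_var (?P A) ?a (?P J) ?b"
    using J by (intro indep_var_restrict[OF indep]) (auto simp: A_def)
  ultimately have *: "prob ((\<lambda>\<omega>. (?a \<omega>, ?b \<omega>)) -` (Ea \<times> Pi\<^sub>E J S) \<inter> space M) =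
      prob (?a -` Ea \<inter> space M) * prob (?b -` Pi\<^sub>E J S \<inter> space M)"
    by (intro indep_varD)
  have "bwbp_config s ?N ?X n (?a \<omega>) = config n \<omega>" for \<omega>
    by (rule bwbp_config_cong) (simp_all add: inA inA'[simplified] bwbp_family_def)
  then have a: "?a \<omega> \<in> Ea \<longleftrightarrow> config n \<omega> = c" for \<omega>
    by (auto simp: Ea_def space_PiM)
  have b: "?b \<omega> \<in> Pi\<^sub>E J S \<longleftrightarrow> (\<forall>\<iota>\<in>J. ?F \<iota> \<omega> \<in> S \<iota>)" for \<omega>
    by (auto simp: PiE_iff)
  have ab: "(\<lambda>\<omega>. (?a \<omega>, ?b \<omega>)) -` (Ea \<times> Pi\<^sub>E J S) \<inter> space M =
      {\<omega> \<in> space M. config n \<omega> = c \<and> (\<forall>\<iota>\<in>J. ?F \<iota> \<omega> \<in> S \<iota>)}"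
    using a b by blast
  have a': "?a -` Ea \<inter> space M = {\<omega> \<in> space M. config n \<omega> = c}"
    using a by blast
  have "q ^ card J \<le> prob (?b -` Pi\<^sub>E J S \<inter> space M)"
  proof (cases "J = {}")
    case True
    then have "?b -` Pi\<^sub>E J S \<inter> space M = space M" using b by blast
    with True show ?thesis by (simp only: prob_space card.empty power_0)
  next
    case False
    have "q ^ card J \<le> (\<Prod>\<iota>\<in>J. prob (?F \<iota> -` S \<iota> \<inter> space M))"
      unfolding prod_constant[symmetric] using q by (intro prod_mono) auto
    also have "\<dots> = prob (\<Inter>\<iota>\<in>J. ?F \<iota> -` S \<iota> \<inter> space M)"
      using False J by (intro indep_varsD[OF indep, symmetric]) auto
    also have "(\<Inter>\<iota>\<in>J. ?F \<iota> -` S \<iota> \<inter> space M) = ?b -` Pi\<^sub>E J S \<inter> space M"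
      unfolding set_eq_iff INT_iff Int_iff vimage_eq b using False by blast
    finally show ?thesis .
  qed
  then show ?thesis
    unfolding *[unfolded ab a'] mult.commute[of "q ^ card J"] by (rule mult_left_mono) simp
qed

lemma AE_eventually_total_ne:
  assumes q: "0 < q" "q \<le> 1"
    and step: "\<And>n c. c \<in> configs n k \<Longrightarrow> \<exists>J S. finite J \<and> J \<subseteq> bwbp_index \<and> card J \<le> d \<and>
      (\<forall>\<iota>\<in>J. index_gen \<iota> = n \<and> q \<le> prob (bwbp_family Nc X \<iota> -` S \<iota> \<inter> space M)) \<and>
      (\<forall>\<omega>. typical \<omega> \<longrightarrow> config n \<omega> = c \<longrightarrow> (\<forall>\<iota>\<in>J. bwbp_family Nc X \<iota> \<omega> \<in> S \<iota>) \<longrightarrow>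
         (\<forall>m>n. total m \<omega> \<noteq> k))"
  shows "AE \<omega> in M. \<forall>\<^sub>F n in sequentially. total n \<omega> \<noteq> k"
proof (rule AE_eventually_ne_if_last_visit[OF measurable_total])
  show "0 < q ^ d" using q by simp
  fix n
  let ?L = "\<lambda>\<omega>. \<forall>m>n. total m \<omega> \<noteq> k"
  let ?C = "\<lambda>c. {\<omega> \<in> space M. config n \<omega> = c}"
  let ?CL = "\<lambda>c. {\<omega> \<in> space M. config n \<omega> = c \<and> ?L \<omega>}"
  have sets_CL: "?CL c \<in> sets M" for c
  proof -
    have "?CL c = ?C c \<inter> {\<omega> \<in> space M. ?L \<omega>}" by auto
    also have "\<dots> \<in> sets M" by measurable
    finally show ?thesis .
  qed
  have "q ^ d * prob (?C c) \<le> prob (?CL c)" if c: "c \<in> configs n k" for c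
  proof -
    obtain J S where J: "finite J" "J \<subseteq> bwbp_index" "card J \<le> d"
      "\<And>\<iota>. \<iota> \<in> J \<Longrightarrow> index_gen \<iota> = n"
      "\<And>\<iota>. \<iota> \<in> J \<Longrightarrow> q \<le> prob (bwbp_family Nc X \<iota> -` S \<iota> \<inter> space M)"
      and L: "\<And>\<omega>. typical \<omega> \<Longrightarrow> config n \<omega> = c \<Longrightarrow> \<forall>\<iota>\<in>J. bwbp_family Nc X \<iota> \<omega> \<in> S \<iota> \<Longrightarrow> ?L \<omega>"
      using step[OF c] by metis
    have "q ^ d * prob (?C c) \<le> q ^ card J * prob (?C c)"
      using q J by (intro mult_right_mono power_decreasing) auto
    also have "\<dots> \<le> prob {\<omega> \<in> space M. config n \<omega> = c \<and> (\<forall>\<iota>\<in>J. bwbp_family Nc X \<iota> \<omega> \<in> S \<iota>)}"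
      using q by (intro prob_config_step J) auto
    also have "\<dots> \<le> prob (?CL c)"
      using AE_typical
      by (intro finite_measure_mono_AE sets_CL, elim AE_mp) (intro AE_I2, use L in blast)
    finally show ?thesis .
  qed
  then have le: "ennreal (q ^ d) * emeasure M (?C c) \<le> emeasure M (?CL c)" if "c \<in> configs n k" for c
    using that q by (auto simp: emeasure_eq_measure simp flip: ennreal_mult)
  have "ennreal (q ^ d) * emeasure M {\<omega> \<in> space M. total n \<omega> = k} =
      ennreal (q ^ d) * (\<integral>\<^sup>+ c. emeasure M (?C c) \<partial>count_space (configs n k))"
    using total_Collect_eq[of n k "\<lambda>_. True"]
    by (simp, subst emeasure_UN_countable) (auto simp: countable_configs disjoint_family_on_def)
  also have "\<dots> = (\<integral>\<^sup>+ c. ennreal (q ^ d) * emeasure M (?C c) \<partial>count_space (configs n k))"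
    by (simp add: nn_integral_cmult)
  also have "\<dots> \<le> (\<integral>\<^sup>+ c. emeasure M (?CL c) \<partial>count_space (configs n k))"
    by (intro nn_integral_mono) (simp add: le)
  also have "\<dots> = emeasure M {\<omega> \<in> space M. total n \<omega> = k \<and> ?L \<omega>}"
    unfolding total_Collect_eq[of n k ?L]
    by (subst emeasure_UN_countable) (auto simp: countable_configs disjoint_family_on_def sets_CL)
  finally show "q ^ d * prob {\<omega> \<in> space M. total n \<omega> = k} \<le> prob {\<omega> \<in> space M. total n \<omega> = k \<and> ?L \<omega>}"
    using q by (simp add: emeasure_eq_measure flip: ennreal_mult)
qed

lemma total_eq_0_mono:
  assumes "total n \<omega> = 0" "n \<le> m"
  shows "total m \<omega> = 0"
  using assms(2,1)
proof (induction m rule: dec_induct)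
  case (step m)
  then have "total m \<omega> = 0" by simp
  then have "{v. config m \<omega> v \<noteq> 0} = {}"
    using finite_supp_bwbp_config[OF s_fin, of Nc X m \<omega>]
    by (auto simp: bwbp_total_eq_config[OF s_fin])
  then show ?case unfolding bwbp_total_Suc[OF s_fin] by simp
qed

lemma AE_eventually_total_ne_if_death_possible:
  assumes a: "a \<in> set_pmf p" and death: "a = 0 \<or> (\<exists>xs\<in>set_pmf (Q a). sum_list xs = 0)"
    and k: "1 \<le> k"
  shows "AE \<omega> in M. \<forall>\<^sub>F n in sequentially. total n \<omega> \<noteq> k"
proof -
  let ?D = "{xs. sum_list xs = (0::nat)}"
  define q where "q = (if a = 0 then pmf p a else min (pmf p a) (measure_pmf.prob (Q a) ?D))"
  have "0 < q" using a death unfolding q_def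
    by (auto simp: pmf_positive intro!: measure_pmf_posI)
  moreover have "q \<le> 1" using pmf_le_1[of p a] by (auto simp: q_def min_le_iff_disj)
  moreover have "\<exists>J S. finite J \<and> J \<subseteq> bwbp_index \<and> card J \<le> 2 * k \<and>
      (\<forall>\<iota>\<in>J. index_gen \<iota> = n \<and> q \<le> prob (bwbp_family Nc X \<iota> -` S \<iota> \<inter> space M)) \<and>
      (\<forall>\<omega>. typical \<omega> \<longrightarrow> config n \<omega> = c \<longrightarrow> (\<forall>\<iota>\<in>J. bwbp_family Nc X \<iota> \<omega> \<in> S \<iota>) \<longrightarrow>
         (\<forall>m>n. total m \<omega> \<noteq> k))"
    if "c \<in> configs n k" for n c
  proof -
    let ?V = "{v. c v \<noteq> 0}"
    have V: "finite ?V" "\<And>v. v \<in> ?V \<Longrightarrow> cell_gen v = n" "(\<Sum>v\<in>?V. c v) = k"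
      using that by (auto simp: configs_def)
    define JN where "JN = (Inl ` ?V :: (cell + nat \<times> nat \<times> cell) set)"
    define JX where "JX = (if a = 0 then {} else
      (\<lambda>(v, i). Inr (a, i, v)) ` (SIGMA v:?V. {1..c v}) :: (cell + nat \<times> nat \<times> cell) set)"
    define S :: "cell + nat \<times> nat \<times> cell \<Rightarrow> (nat + nat list) set"
      where "S = case_sum (\<lambda>_. Inl ` {a}) (\<lambda>_. Inr ` ?D)"
    have "card JN \<le> card ?V" unfolding JN_def by (intro card_image_le V)
    also have "\<dots> \<le> (\<Sum>v\<in>?V. c v)" unfolding card_eq_sum by (rule sum_mono) auto
    finally have "card JN \<le> k" using V by simp
    moreover have "card JX \<le> k"
    proof (cases "a = 0")
      case False
      then have "card JX \<le> card (SIGMA v:?V. {1..c v})"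
        unfolding JX_def using V(1) by (simp only: if_False) (intro card_image_le finite_SigmaI, auto)
      also have "\<dots> = k" using V by (simp add: card_SigmaI)
      finally show ?thesis .
    qed (simp add: JX_def)
    moreover have "finite JN" "finite JX" using V by (auto simp: JN_def JX_def)
    ultimately have "finite (JN \<union> JX)" "card (JN \<union> JX) \<le> 2 * k"
      using card_Un_le[of JN JX] by auto
    moreover have "JN \<union> JX \<subseteq> bwbp_index"
      by (auto simp: JN_def JX_def bwbp_index_def)
    moreover have "\<forall>\<iota>\<in>JN \<union> JX. index_gen \<iota> = n \<and>
        q \<le> prob (bwbp_family Nc X \<iota> -` S \<iota> \<inter> space M)"
    proof
      fix \<iota> assume "\<iota> \<in> JN \<union> JX"
      then consider v where "\<iota> = Inl v" "v \<in> ?V"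
        | v i where "\<iota> = Inr (a, i, v)" "v \<in> ?V" "1 \<le> i" "1 \<le> a"
        by (auto simp: JN_def JX_def split: if_splits)
      then show "index_gen \<iota> = n \<and> q \<le> prob (bwbp_family Nc X \<iota> -` S \<iota> \<inter> space M)"
      proof cases
        case 1
        then show ?thesis
          using V(2) prob_family_Inl[of v "{a}"] by (auto simp: S_def q_def measure_pmf_single)
      next
        case 2
        then show ?thesis
          using V(2) prob_family_Inr[of a i v ?D] by (auto simp: S_def q_def)
      qed
    qed
    moreover have "total m \<omega> \<noteq> k"
      if \<omega>: "typical \<omega>" "config n \<omega> = c" and fam: "\<forall>\<iota>\<in>JN \<union> JX. bwbp_family Nc X \<iota> \<omega> \<in> S \<iota>"
        and "n < m" for m \<omega>
    proof -
      have N: "Nc v \<omega> = a" if "v \<in> ?V" for v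
        using fam[rule_format, of "Inl v"] that by (auto simp: JN_def S_def bwbp_family_def)
      have X0: "sum_list (X a i v \<omega>) = 0" if "v \<in> ?V" "i \<in> {1..c v}" "a \<noteq> 0" for i v
      proof -
        have "Inr (a, i, v) \<in> JX" using that by (force simp: JX_def)
        then show ?thesis
          using fam[rule_format, of "Inr (a, i, v)"] by (auto simp: S_def bwbp_family_def)
      qed
      have "bwbp_offspring Nc X v i \<omega> = 0" if "v \<in> ?V" "i \<in> {1..c v}" for v i
        using that N[OF that(1)] X0[OF that] \<omega> by (simp add: typical_offspring)
      then have "total (Suc n) \<omega> = 0"
        unfolding bwbp_total_Suc[OF s_fin] \<omega> by simp
      then show ?thesis
        using total_eq_0_mono[of "Suc n" \<omega> m] \<open>n < m\<close> k by simp
    qed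
    ultimately show ?thesis by blast
  qed
  ultimately show ?thesis by (rule AE_eventually_total_ne)
qed

lemma AE_eventually_total_ne_if_no_death:
  assumes no_death: "0 \<notin> set_pmf p" "\<And>a xs. a \<in> set_pmf p \<Longrightarrow> xs \<in> set_pmf (Q a) \<Longrightarrow> sum_list xs \<noteq> 0"
    and a: "a \<in> set_pmf p" and growth: "xs \<in> set_pmf (Q a)" "2 \<le> sum_list xs"
    and k: "1 \<le> k"
  shows "AE \<omega> in M. \<forall>\<^sub>F n in sequentially. total n \<omega> \<noteq> k"
proof -
  let ?G = "{xs. 2 \<le> sum_list (xs :: nat list)}"
  define q where "q = min (pmf p a) (measure_pmf.prob (Q a) ?G)"
  have a1: "1 \<le> a" using a no_death(1) by (cases a) auto
  have offspring_ge: "1 \<le> bwbp_offspring Nc X v i \<omega>" if "typical \<omega>" "1 \<le> i" for v i \<omega>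
  proof -
    have "Nc v \<omega> \<in> set_pmf p" using that by (simp add: typical_def)
    moreover from this have "Nc v \<omega> \<noteq> 0" using no_death(1) by metis
    moreover from this have "X (Nc v \<omega>) i v \<omega> \<in> set_pmf (Q (Nc v \<omega>))"
      using that by (simp add: typical_def)
    ultimately have "sum_list (X (Nc v \<omega>) i v \<omega>) \<noteq> 0" using no_death(2) by blast
    with \<open>Nc v \<omega> \<noteq> 0\<close> that show ?thesis
      by (simp add: typical_offspring Suc_le_eq del: sum_list_eq_0_iff)
  qed
  have mono: "total n \<omega> \<le> total m \<omega>" if "typical \<omega>" "n \<le> m" for n m \<omega>
    using that(2)
  proof (rule lift_Suc_mono_le[rotated])
    fix n
    have "(\<Sum>v | config n \<omega> v \<noteq> 0. \<Sum>i = 1..config n \<omega> v. 1) \<le> total (Suc n) \<omega>"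
      unfolding bwbp_total_Suc[OF s_fin] using offspring_ge[OF that(1)] by (intro sum_mono) auto
    then show "total n \<omega> \<le> total (Suc n) \<omega>" by (simp add: bwbp_total_eq_config[OF s_fin])
  qed
  have "0 < q" using a growth unfolding q_def
    by (auto simp: pmf_positive intro!: measure_pmf_posI)
  moreover have "q \<le> 1" using pmf_le_1[of p a] by (auto simp: q_def min_le_iff_disj)
  moreover have "\<exists>J S. finite J \<and> J \<subseteq> bwbp_index \<and> card J \<le> 2 \<and>
      (\<forall>\<iota>\<in>J. index_gen \<iota> = n \<and> q \<le> prob (bwbp_family Nc X \<iota> -` S \<iota> \<inter> space M)) \<and>
      (\<forall>\<omega>. typical \<omega> \<longrightarrow> config n \<omega> = c \<longrightarrow> (\<forall>\<iota>\<in>J. bwbp_family Nc X \<iota> \<omega> \<in> S \<iota>) \<longrightarrow>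
         (\<forall>m>n. total m \<omega> \<noteq> k))"
    if "c \<in> configs n k" for n c
  proof -
    let ?V = "{v. c v \<noteq> 0}"
    have V: "finite ?V" "\<And>v. v \<in> ?V \<Longrightarrow> cell_gen v = n" "(\<Sum>v\<in>?V. c v) = k"
      using that by (auto simp: configs_def)
    then have "?V \<noteq> {}" using k by (metis not_one_le_zero sum.empty)
    then obtain u where u: "u \<in> ?V" by blast
    define J :: "(cell + nat \<times> nat \<times> cell) set" where "J = {Inl u, Inr (a, 1, u)}"
    define S :: "cell + nat \<times> nat \<times> cell \<Rightarrow> (nat + nat list) set"
      where "S = case_sum (\<lambda>_. Inl ` {a}) (\<lambda>_. Inr ` ?G)"
    have "finite J" "card J \<le> 2" "J \<subseteq> bwbp_index"
      using a1 by (auto simp: J_def bwbp_index_def)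
    moreover have "\<forall>\<iota>\<in>J. index_gen \<iota> = n \<and> q \<le> prob (bwbp_family Nc X \<iota> -` S \<iota> \<inter> space M)"
      using V(2)[OF u] a1 prob_family_Inl[of u "{a}"] prob_family_Inr[of a 1 u ?G]
      by (auto simp: J_def S_def q_def measure_pmf_single)
    moreover have "total m \<omega> \<noteq> k"
      if \<omega>: "typical \<omega>" "config n \<omega> = c" and fam: "\<forall>\<iota>\<in>J. bwbp_family Nc X \<iota> \<omega> \<in> S \<iota>"
        and "n < m" for m \<omega>
    proof -
      have "Nc u \<omega> = a" "2 \<le> sum_list (X a 1 u \<omega>)"
        using fam by (auto simp: J_def S_def bwbp_family_def)
      then have "2 \<le> bwbp_offspring Nc X u 1 \<omega>"
        using \<omega> a1 by (simp add: typical_offspring)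
      then have "(\<Sum>i = 1..c u. 1) < (\<Sum>i = 1..c u. bwbp_offspring Nc X u i \<omega>)"
        using u offspring_ge[OF \<omega>(1)] by (intro sum_strict_mono_ex1) (auto intro!: bexI[of _ 1])
      then have "(\<Sum>v\<in>?V. \<Sum>i = 1..c v. 1) < (\<Sum>v\<in>?V. \<Sum>i = 1..c v. bwbp_offspring Nc X v i \<omega>)"
        using offspring_ge[OF \<omega>(1)]
        by (intro sum_strict_mono_ex1[OF V(1)] ballI bexI[OF _ u] sum_mono) auto
      then have "k < total (Suc n) \<omega>"
        unfolding bwbp_total_Suc[OF s_fin] \<omega> using V by simp
      also have "\<dots> \<le> total m \<omega>" using \<omega> \<open>n < m\<close> by (intro mono) auto
      finally show ?thesis by simp
    qed
    ultimately show ?thesis by blast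
  qed
  ultimately show ?thesis by (rule AE_eventually_total_ne)
qed

lemma extinction_or_explosion:
  assumes "\<And>k. 1 \<le> k \<Longrightarrow> AE \<omega> in M. \<forall>\<^sub>F n in sequentially. total n \<omega> \<noteq> k"
  shows "prob {\<omega> \<in> space M. (\<lambda>n. real (total n \<omega>)) \<longlonglongrightarrow> 0}
       + prob {\<omega> \<in> space M. filterlim (\<lambda>n. real (total n \<omega>)) at_top sequentially} = 1"
proof -
  let ?E = "{\<omega> \<in> space M. (\<lambda>n. real (total n \<omega>)) \<longlonglongrightarrow> 0}"
  let ?I = "{\<omega> \<in> space M. filterlim (\<lambda>n. real (total n \<omega>)) at_top sequentially}"
  have E: "(\<lambda>n. real (total n \<omega>)) \<longlonglongrightarrow> 0 \<longleftrightarrow> (\<exists>n. total n \<omega> = 0)" for \<omega>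
  proof
    assume "(\<lambda>n. real (total n \<omega>)) \<longlonglongrightarrow> 0"
    then have "\<forall>\<^sub>F n in sequentially. real (total n \<omega>) < 1" by (rule order_tendstoD) simp
    then show "\<exists>n. total n \<omega> = 0" by (auto simp: eventually_sequentially)
  next
    assume "\<exists>n. total n \<omega> = 0"
    then obtain n where "total n \<omega> = 0" ..
    then have "\<forall>\<^sub>F m in sequentially. real (total m \<omega>) = 0"
      using total_eq_0_mono by (auto simp: eventually_sequentially)
    then show "(\<lambda>n. real (total n \<omega>)) \<longlonglongrightarrow> 0" by (rule tendsto_eventually)
  qed
  have I: "filterlim (\<lambda>n. real (total n \<omega>)) at_top sequentially \<longleftrightarrow>
      (\<forall>K. \<exists>n. \<forall>m\<ge>n. K \<le> total m \<omega>)" for \<omega>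
    by (simp add: filterlim_sequentially_iff_filterlim_real[symmetric] filterlim_at_top
        eventually_sequentially)
  have [measurable]: "?E \<in> sets M" "?I \<in> sets M"
    unfolding E I by measurable
  have "?E \<inter> ?I = {}"
  proof -
    have False if n: "total n \<omega> = 0" and K: "\<forall>K. \<exists>n. \<forall>m\<ge>n. K \<le> total m \<omega>" for \<omega> n
    proof -
      obtain n' where "\<forall>m\<ge>n'. 1 \<le> total m \<omega>" using K by blast
      then have "1 \<le> total (max n n') \<omega>" by simp
      then show False using total_eq_0_mono[OF n, of "max n n'"] by simp
    qed
    then show ?thesis unfolding E I by blast
  qed
  then have "prob ?E + prob ?I = prob (?E \<union> ?I)"
    by (intro finite_measure_Union[symmetric]) auto
  also have "\<dots> = 1"
  proof (subst prob_eq_1)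
    have "AE \<omega> in M. \<forall>k\<ge>1. \<forall>\<^sub>F n in sequentially. total n \<omega> \<noteq> k"
      using assms by (simp add: AE_all_countable)
    then show "AE \<omega> in M. \<omega> \<in> ?E \<union> ?I"
    proof (rule AE_mp, intro AE_I2 impI)
      fix \<omega> assume \<omega>: "\<omega> \<in> space M" "\<forall>k\<ge>1. \<forall>\<^sub>F n in sequentially. total n \<omega> \<noteq> k"
      show "\<omega> \<in> ?E \<union> ?I"
      proof (cases "\<exists>n. total n \<omega> = 0")
        case True
        then show ?thesis using \<omega> E by simp
      next
        case False
        have "\<forall>\<^sub>F n in sequentially. K \<le> total n \<omega>" for K
        proof -
          have "\<forall>\<^sub>F n in sequentially. \<forall>k\<in>{1..<K}. total n \<omega> \<noteq> k"
            using \<omega> by (intro eventually_ball_finite) auto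
          then show ?thesis
            using False by (elim eventually_mono) (metis atLeastLessThan_iff less_one not_le)
        qed
        then have "filterlim (\<lambda>n. real (total n \<omega>)) at_top sequentially"
          unfolding I by (simp add: eventually_sequentially)
        then show ?thesis using \<omega> by simp
      qed
    qed
  qed simp
  finally show ?thesis .
qed

end

theorem theorem1:
  fixes M :: "'a measure"
    and p :: "nat pmf"
    and Q :: "nat \<Rightarrow> nat list pmf"
    and Nc :: "cell \<Rightarrow> 'a \<Rightarrow> nat"
    and X :: "nat \<Rightarrow> nat \<Rightarrow> cell \<Rightarrow> 'a \<Rightarrow> nat list"
    and s :: "nat \<Rightarrow> nat"
  assumes "prob_space M"
    and Q_len: "\<And>k. 1 \<le> k \<Longrightarrow> set_pmf (Q k) \<subseteq> {xs. length xs = k}"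
    and indep: "prob_space.indep_vars M (\<lambda>_. count_space UNIV) (bwbp_family Nc X) bwbp_index"
    and law_N: "\<And>v. distr M (count_space UNIV) (Nc v) = measure_pmf p"
    and law_X: "\<And>k i v. 1 \<le> k \<Longrightarrow> 1 \<le> i \<Longrightarrow>
                  distr M (count_space UNIV) (X k i v) = measure_pmf (Q k)"
    and finite_mean: "(\<integral>\<^sup>+ k. ennreal (real k) \<partial>measure_pmf p) < \<infinity>"
    and gamma_pos: "0 < bwbp_gamma p Q"
    and gamma_fin: "bwbp_gamma p Q < \<infinity>"
    and p1: "pmf p 1 < 1"
    and Z1: "(\<Sum>k. pmf p (Suc k) * measure_pmf.prob (Q (Suc k)) {xs. sum_list xs = 1}) < 1"
    and two: "\<exists>j k. 1 \<le> j \<and> j \<le> k \<and>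
                 pmf p k * measure_pmf.prob (Q k) {xs. xs ! (j - 1) \<ge> 2} > 0"
    and s_fin: "finite {k. s k > 0}"
  shows "measure M {\<omega> \<in> space M. (\<lambda>n. real (bwbp_total s Nc X n \<omega>)) \<longlonglongrightarrow> 0}
       + measure M {\<omega> \<in> space M. filterlim (\<lambda>n. real (bwbp_total s Nc X n \<omega>)) at_top sequentially}
       = 1"
proof -
  interpret bwbp M p Q Nc X s
    by (intro bwbp.intro bwbp_axioms.intro assms)
  show ?thesis
  proof (rule extinction_or_explosion)
    fix k :: nat assume k: "1 \<le> k"
    show "AE \<omega> in M. \<forall>\<^sub>F n in sequentially. total n \<omega> \<noteq> k"
    proof (cases "\<exists>a\<in>set_pmf p. a = 0 \<or> (\<exists>xs\<in>set_pmf (Q a). sum_list xs = 0)")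
      case True
      then show ?thesis using AE_eventually_total_ne_if_death_possible k by blast
    next
      case False
      obtain j a where j: "1 \<le> j" "j \<le> a"
        and pos: "0 < pmf p a * measure_pmf.prob (Q a) {xs. xs ! (j - 1) \<ge> 2}"
        using two by blast
      have "pmf p a \<noteq> 0" using pos by auto
      then have "a \<in> set_pmf p" by (simp add: set_pmf_iff)
      have "measure_pmf.prob (Q a) {xs. xs ! (j - 1) \<ge> 2} \<noteq> 0" using pos by auto
      then have "set_pmf (Q a) \<inter> {xs. xs ! (j - 1) \<ge> 2} \<noteq> {}"
        by (simp add: measure_pmf_zero_iff)
      then obtain xs where xs: "xs \<in> set_pmf (Q a)" "2 \<le> xs ! (j - 1)" by blast
      have "length xs = a" using Q_len[of a] xs j by auto
      then have "xs ! (j - 1) \<le> sum_list xs" using j by (intro elem_le_sum_list) simp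
      then show ?thesis
        using AE_eventually_total_ne_if_no_death[OF _ _ \<open>a \<in> set_pmf p\<close> xs(1) _ k] False xs(2)
        by auto
    qed
  qed
qed

end
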